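(* For $n \geq 6$ we have $\mathrm{mex}(n;2) = \left\lceil \frac{(n-1)^2}{4} \right\rceil$. For odd $n \ge 6$ the unique (up to isomorphism) graph with order $n$, mp-number $2$ and size $\mathrm{mex}(n;2)$ is $T_{n,2}^*$, whilst for even $n \ge 6$ the unique such graph (up to isomorphism) is $T_{n,2}^*$ with one edge added between its two partite sets.
   Context: All graphs are finite, simple and undirected; the order of a graph is its number of vertices and its size is its number of edges. A monophonic path is an induced (chordless) path. A set $S$ of vertices of a graph $G$ is in monophonic position if no monophonic path of $G$ contains more than two elements of $S$; the monophonic position number (mp-number) is the largest size of such a set. $\mathrm{mex}(n;2)$ is the largest possible size of a graph with order $n$ and mp-number $2$. $T_{n,2}^*$ is the graph obtained from the complete bipartite graph $K_{\lceil n/2 \rceil, \lfloor n/2 \rfloor}$ by deleting the edges of a matching of size $\lfloor n/2 \rfloor$; its partite sets are those of the complete bipartite graph. *)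

theory Defs
  imports Complex_Main
begin

datatype 'a graph = Graph (verts: "'a set") (edges: "'a set set")

definition simple_graph :: "'a graph \<Rightarrow> bool" where
  "simple_graph G \<longleftrightarrow> finite (verts G) \<and> (\<forall>e\<in>edges G. e \<subseteq> verts G \<and> card e = 2)"

definition graph_order :: "'a graph \<Rightarrow> nat" where
  "graph_order G = card (verts G)"

definition graph_size :: "'a graph \<Rightarrow> nat" where
  "graph_size G = card (edges G)"

definition isomorphic :: "'a graph \<Rightarrow> 'b graph \<Rightarrow> bool" where
  "isomorphic G H \<longleftrightarrow>
     (\<exists>f. bij_betw f (verts G) (verts H) \<and>
          (\<forall>u\<in>verts G. \<forall>v\<in>verts G. {u, v} \<in> edges G \<longleftrightarrow> {f u, f v} \<in> edges H))"

text \<open>Paths are given by their vertex sequences.\<close>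

definition path :: "'a graph \<Rightarrow> 'a list \<Rightarrow> bool" where
  "path G p \<longleftrightarrow>
     p \<noteq> [] \<and> distinct p \<and> set p \<subseteq> verts G \<and>
     (\<forall>i. Suc i < length p \<longrightarrow> {p ! i, p ! Suc i} \<in> edges G)"

definition monophonic_path :: "'a graph \<Rightarrow> 'a list \<Rightarrow> bool" where
  "monophonic_path G p \<longleftrightarrow>
     path G p \<and> (\<forall>i j. Suc i < j \<and> j < length p \<longrightarrow> {p ! i, p ! j} \<notin> edges G)"

definition monophonic_position :: "'a graph \<Rightarrow> 'a set \<Rightarrow> bool" where
  "monophonic_position G S \<longleftrightarrow>
     S \<subseteq> verts G \<and> (\<forall>p. monophonic_path G p \<longrightarrow> card (S \<inter> set p) \<le> 2)"

definition mp_number :: "'a graph \<Rightarrow> nat" where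
  "mp_number G = Max {card S | S. monophonic_position G S}"

text \<open>Every finite graph is isomorphic to one whose vertices are natural numbers, so
  \<open>nat graph\<close> suffices for the maximum. It is only meaningful if some graph of order
  \<open>n\<close> has mp-number \<open>k\<close>.\<close>

definition mex :: "nat \<Rightarrow> nat \<Rightarrow> nat" where
  "mex n k =
     Max {graph_size G | G :: nat graph. simple_graph G \<and> graph_order G = n \<and> mp_number G = k}"

definition complete_bipartite :: "nat \<Rightarrow> nat \<Rightarrow> (nat + nat) graph" where
  "complete_bipartite a b =
     Graph (Inl ` {..<a} \<union> Inr ` {..<b}) {{Inl i, Inr j} | i j. i < a \<and> j < b}"

definition add_edge :: "'a graph \<Rightarrow> 'a set \<Rightarrow> 'a graph" where
  "add_edge G e = Graph (verts G) (insert e (edges G))"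

definition delete_edges :: "'a graph \<Rightarrow> 'a set set \<Rightarrow> 'a graph" where
  "delete_edges G M = Graph (verts G) (edges G - M)"

text \<open>The complete bipartite graph that \<open>T_star n\<close> is obtained from: \<open>(n + 1) div 2\<close> is
  \<open>n / 2\<close> rounded up.\<close>

definition T_base :: "nat \<Rightarrow> (nat + nat) graph" where
  "T_base n = complete_bipartite ((n + 1) div 2) (n div 2)"

text \<open>Any two matchings of size \<open>n div 2\<close> in \<open>T_base n\<close> are related by an automorphism,
  so it does not matter which one is deleted.\<close>

definition T_star :: "nat \<Rightarrow> (nat + nat) graph" where
  "T_star n = delete_edges (T_base n) {{Inl i, Inr i} | i. i < n div 2}"

text \<open>The edges that can be added to \<open>T_star n\<close> between its two partite sets.\<close>

definition T_star_missing :: "nat \<Rightarrow> (nat + nat) set set" where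
  "T_star_missing n = edges (T_base n) - edges (T_star n)"

definition extremal :: "nat \<Rightarrow> 'a graph \<Rightarrow> bool" where
  "extremal n G \<longleftrightarrow>
     simple_graph G \<and> graph_order G = n \<and> mp_number G = 2 \<and> graph_size G = mex n 2"

text \<open>\<open>H\<close> is, up to isomorphism, the only extremal graph. The type \<open>'a\<close> of the competing
  graphs is arbitrary, hence the explicit type argument.\<close>

definition unique_extremal :: "'a itself \<Rightarrow> nat \<Rightarrow> 'b graph \<Rightarrow> bool" where
  "unique_extremal (_ :: 'a itself) n H \<longleftrightarrow>
     extremal n H \<and> (\<forall>G :: 'a graph. extremal n G \<longrightarrow> isomorphic G H)"

end

theory Submission
  imports Defs
begin

text \<open>
  A graph of order at least 3 has mp-number 2 iff every three vertices lie on a common induced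
  path. Hence it is triangle-free, and from order 5 on it has no two vertices with the same
  neighbourhood. Suppose it has at least \<open>(n - 1)^2 / 4\<close> edges.

  If it contains a 5-cycle \<open>C\<close>, Mantel's theorem outside \<open>C\<close> shows that all outer vertices have two
  neighbours on \<open>C\<close>, except possibly one, which then has one neighbour. An outer vertex with two
  neighbours on \<open>C\<close> can be exchanged with a vertex \<open>a\<close> of \<open>C\<close>; as it is not a twin of \<open>a\<close>, comparing
  the two cycles shows that, for a suitable \<open>C\<close>, there is an exceptional outer vertex, and that it is
  adjacent to all the others. This forces \<open>n = 7\<close> and a single graph, which has three vertices on no
  induced path.

  If it contains no 5-cycle and is not bipartite, let \<open>v\<close> have maximum degree. Then some edge \<open>ab\<close> lies
  at distance at least 3 from \<open>v\<close>, and \<open>a\<close>, \<open>b\<close> and \<open>v\<close> have disjoint neighbourhoods, which makes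
  the degree sum outside the neighbourhood of \<open>v\<close> too small.

  In the bipartite case, twin-freeness leaves at most one vertex of each part that is joined to the
  whole other part. This bounds the size, with equality only if the missing edges form a matching.
\<close>

section \<open>Edge counting and induced paths\<close>

locale sgraph =
  fixes G :: "'a graph"
  assumes simple: "simple_graph G"
begin

definition adj :: "'a \<Rightarrow> 'a \<Rightarrow> bool" where
  "adj u v \<longleftrightarrow> {u, v} \<in> edges G"

definition nbh :: "'a \<Rightarrow> 'a set" where
  "nbh v = {u. adj v u}"

definition edges_in :: "'a set \<Rightarrow> 'a set set" where
  "edges_in X = {e \<in> edges G. e \<subseteq> X}"

lemma nbh_iff: "u \<in> nbh v \<longleftrightarrow> adj v u"
  by (simp add: nbh_def)

lemma finite_verts: "finite (verts G)"
  using simple by (simp add: simple_graph_def)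

lemma adj_commute: "adj u v \<longleftrightarrow> adj v u"
  by (simp add: adj_def insert_commute)

lemma adj_irrefl [simp]: "\<not> adj u u"
  using simple by (force simp: simple_graph_def adj_def)

lemma adj_verts: "adj u v \<Longrightarrow> u \<in> verts G" "adj u v \<Longrightarrow> v \<in> verts G"
  using simple by (auto simp: simple_graph_def adj_def)

lemma edge_cases:
  assumes "e \<in> edges G"
  obtains u v where "e = {u, v}" "adj u v"
  using assms simple by (metis adj_def card_2_iff simple_graph_def)

lemma finite_edges: "finite (edges G)"
proof (rule finite_subset)
  show "edges G \<subseteq> Pow (verts G)"
    using simple by (auto simp: simple_graph_def)
qed (simp add: finite_verts)

lemma finite_edges_in [simp]: "finite (edges_in X)"
  by (simp add: edges_in_def finite_edges)

lemma nbh_subset: "nbh v \<subseteq> verts G"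
  by (auto simp: nbh_def adj_verts)

lemma finite_nbh [simp]: "finite (nbh v)"
  using nbh_subset finite_verts finite_subset by blast

lemma edges_in_verts: "edges_in (verts G) = edges G"
  using simple by (auto simp: simple_graph_def edges_in_def)

lemma edges_in_independent:
  assumes "\<And>u v. u \<in> X \<Longrightarrow> v \<in> X \<Longrightarrow> \<not> adj u v"
  shows "edges_in X = {}"
  using assms by (auto simp: edges_in_def elim!: edge_cases)

lemma edges_in_empty [simp]: "edges_in {} = {}"
  using edges_in_independent[of "{}"] by simp

lemma card_edges_in_insert:
  assumes "v \<notin> X"
  shows "card (edges_in (insert v X)) = card (edges_in X) + card (nbh v \<inter> X)"
proof -
  let ?S = "(\<lambda>u. {v, u}) ` (nbh v \<inter> X)"
  have "e \<in> edges_in X \<union> ?S" if e: "e \<in> edges_in (insert v X)" for e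
  proof -
    obtain a b where "e = {a, b}" "adj a b"
      using e by (auto simp: edges_in_def elim: edge_cases)
    then show ?thesis
      using e by (auto simp: edges_in_def nbh_def adj_commute doubleton_eq_iff image_iff)
  qed
  then have "edges_in (insert v X) = edges_in X \<union> ?S"
    by (auto simp: edges_in_def nbh_def adj_def)
  moreover have "edges_in X \<inter> ?S = {}"
    using assms by (auto simp: edges_in_def)
  moreover have "card ?S = card (nbh v \<inter> X)"
    by (rule card_image) (auto simp: inj_on_def doubleton_eq_iff)
  ultimately show ?thesis
    by (simp add: card_Un_disjoint)
qed

lemma sum_nbh_insert:
  assumes "finite C" "v \<notin> X"
  shows "(\<Sum>x\<in>C. card (nbh x \<inter> insert v X)) = (\<Sum>x\<in>C. card (nbh x \<inter> X)) + card (nbh v \<inter> C)"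
proof -
  have "card (nbh x \<inter> insert v X) = card (nbh x \<inter> X) + (if adj v x then 1 else 0)" for x
    using assms by (auto simp: nbh_iff adj_commute Int_insert_right)
  moreover have "(\<Sum>x\<in>C. if adj v x then 1 else 0) = card (nbh v \<inter> C)"
    using assms(1) by (simp add: sum.If_cases nbh_def Int_commute)
  ultimately show ?thesis
    by (simp add: sum.distrib)
qed

lemma card_edges_in_cover:
  assumes "finite C" "C \<inter> I = {}" "\<And>u v. u \<in> I \<Longrightarrow> v \<in> I \<Longrightarrow> \<not> adj u v"
  shows "card (edges_in (C \<union> I)) + card (edges_in C) = (\<Sum>x\<in>C. card (nbh x \<inter> (C \<union> I)))"
  using assms(1,2)
proof (induction C)
  case empty
  then show ?case
    using assms(3) edges_in_independent[of I] by simp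
next
  case (insert v C)
  then have "v \<notin> C \<union> I"
    by simp
  then show ?case
    using insert card_edges_in_insert[of v "C \<union> I"] card_edges_in_insert[of v C]
      sum_nbh_insert[of C v "C \<union> I"]
    by (simp add: nbh_def Int_insert_right)
qed

lemma card_edges_in_Un:
  assumes "finite X" "X \<inter> C = {}"
  shows "card (edges_in (X \<union> C)) =
    card (edges_in X) + card (edges_in C) + (\<Sum>x\<in>X. card (nbh x \<inter> C))"
  using assms
proof (induction X)
  case empty
  then show ?case
    by simp
next
  case (insert v X)
  have "card (nbh v \<inter> (X \<union> C)) = card (nbh v \<inter> X) + card (nbh v \<inter> C)"
    using insert.prems by (subst card_Un_disjoint[symmetric]) (auto simp: Int_Un_distrib)
  then show ?case
    using insert card_edges_in_insert[of v "X \<union> C"] card_edges_in_insert[of v X] by simp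
qed

lemma mantel:
  assumes fin: "finite X"
    and tri: "\<And>u v w. adj u v \<Longrightarrow> adj v w \<Longrightarrow> adj u w \<Longrightarrow> False"
  shows "4 * card (edges_in X) \<le> (card X)\<^sup>2"
proof (cases "X = {}")
  case True
  then show ?thesis
    by simp
next
  case False
  let ?d = "\<lambda>x. card (nbh x \<inter> X)"
  define D where "D = Max (?d ` X)"
  have le: "?d x \<le> D" if "x \<in> X" for x
    unfolding D_def using fin that by simp
  have "D \<in> ?d ` X"
    unfolding D_def by (rule Max_in) (use fin False in auto)
  then obtain v where v: "v \<in> X" "?d v = D"
    by blast
  let ?A = "nbh v \<inter> X"
  have "card (edges_in ((X - ?A) \<union> ?A)) + card (edges_in (X - ?A))
      = (\<Sum>x\<in>X - ?A. card (nbh x \<inter> ((X - ?A) \<union> ?A)))"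
    by (rule card_edges_in_cover) (use fin tri in \<open>auto simp: nbh_def\<close>)
  moreover have "(X - ?A) \<union> ?A = X"
    by auto
  ultimately have "card (edges_in X) \<le> (\<Sum>x\<in>X - ?A. ?d x)"
    by simp
  also have "\<dots> \<le> (\<Sum>x\<in>X - ?A. D)"
    by (rule sum_mono) (simp add: le)
  also have "\<dots> = (card X - D) * D"
    using fin v by (simp add: card_Diff_subset)
  finally have "int (card (edges_in X)) \<le> int ((card X - D) * D)"
    by (rule of_nat_mono)
  also have "\<dots> = (int (card X) - int D) * int D"
    using fin v(2) card_mono[of X ?A] by (simp add: of_nat_diff)
  finally have "int (card (edges_in X)) \<le> (int (card X) - int D) * int D" .
  moreover have "4 * ((int (card X) - int D) * int D) \<le> (int (card X))\<^sup>2"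
    using sum_squares_ge_zero[of "int (card X) - 2 * int D" 0]
    by (simp add: power2_eq_square algebra_simps)
  ultimately have "4 * int (card (edges_in X)) \<le> (int (card X))\<^sup>2"
    by linarith
  then show ?thesis
    by (metis of_nat_le_iff of_nat_mult of_nat_numeral of_nat_power)
qed

lemma monophonic_path_adj_iff:
  assumes p: "monophonic_path G p" and ij: "i < length p" "j < length p"
  shows "adj (p ! i) (p ! j) \<longleftrightarrow> j = Suc i \<or> i = Suc j"
proof -
  have "adj (p ! i) (p ! j) \<longleftrightarrow> j = Suc i" if "i < j" "j < length p" for i j
    using p that unfolding monophonic_path_def path_def adj_def
    by (metis Suc_lessI)
  from this[of i j] this[of j i] show ?thesis
    using ij by (cases i j rule: linorder_cases) (auto simp: adj_commute)
qed

lemma monophonic_path_ex_adj: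
  assumes p: "monophonic_path G p" and u: "u \<in> set p" "v \<in> set p" "u \<noteq> v"
  shows "\<exists>w\<in>set p. adj u w"
proof -
  obtain i j where ij: "i < length p" "p ! i = u" "j < length p" "p ! j = v"
    using u by (metis in_set_conv_nth)
  then have "i \<noteq> j"
    using u by auto
  then have "Suc i < length p \<or> (\<exists>k. i = Suc k)"
    using ij by (metis Suc_lessI gr0_conv_Suc not_less_eq not_less_iff_gr_or_eq zero_less_iff_neq_zero)
  then show ?thesis
  proof
    assume "Suc i < length p"
    then show ?thesis
      using monophonic_path_adj_iff[OF p, of i "Suc i"] ij nth_mem by metis
  next
    assume "\<exists>k. i = Suc k"
    then show ?thesis
      using monophonic_path_adj_iff[OF p, of i "i - 1"] ij nth_mem
      by (metis Suc_lessD diff_Suc_1)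
  qed
qed

lemma monophonic_path_no_claw:
  assumes p: "monophonic_path G p" and "{x, u, v, w} \<subseteq> set p" "distinct [u, v, w]"
    "adj x u" "adj x v" "adj x w"
  shows False
proof -
  obtain i j k l where "i < length p" "p ! i = x" "j < length p" "p ! j = u"
    "k < length p" "p ! k = v" "l < length p" "p ! l = w"
    using assms(2) by (metis in_set_conv_nth insert_subset)
  then show False
    using assms monophonic_path_adj_iff[OF p, of i j] monophonic_path_adj_iff[OF p, of i k]
      monophonic_path_adj_iff[OF p, of i l] by auto
qed

end

section \<open>Graphs with monophonic position number 2\<close>

lemma (in sgraph) monophonic_path_twins:
  assumes p: "monophonic_path G p" and ij: "i < j" "j < length p"
    and twins: "nbh (p ! i) = nbh (p ! j)"
  shows "i = 0 \<and> j = 2 \<and> length p = 3"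
proof -
  have iff: "k = Suc i \<or> i = Suc k \<longleftrightarrow> k = Suc j \<or> j = Suc k" if "k < length p" for k
    using monophonic_path_adj_iff[OF p, of i k] monophonic_path_adj_iff[OF p, of j k] ij that twins
    by (metis less_trans nbh_iff)
  have "i = 0"
    using iff[of "i - 1"] ij by (cases i) auto
  moreover have "j = 2"
    using iff[of 1] ij \<open>i = 0\<close> by auto
  moreover have "length p = 3"
    using iff[of 3] ij \<open>i = 0\<close> \<open>j = 2\<close> by force
  ultimately show ?thesis
    by simp
qed

locale mp2_graph = sgraph +
  assumes order: "card (verts G) \<ge> 6"
    and mp: "mp_number G = 2"
begin

lemma triple_on_path:
  assumes "{u, v, w} \<subseteq> verts G" "distinct [u, v, w]"
  obtains p where "monophonic_path G p" "{u, v, w} \<subseteq> set p"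
proof -
  have "False" if none: "\<And>p. monophonic_path G p \<Longrightarrow> \<not> {u, v, w} \<subseteq> set p"
  proof -
    let ?S = "{u, v, w}"
    have card: "card ?S = 3"
      using assms by simp
    have "card (?S \<inter> set p) \<le> 2" if "monophonic_path G p" for p
    proof -
      have "?S \<inter> set p \<subset> ?S"
        using none[OF that] by blast
      then have "card (?S \<inter> set p) < card ?S"
        by (intro psubset_card_mono) auto
      then show ?thesis
        using card by simp
    qed
    then have "monophonic_position G ?S"
      using assms by (simp add: monophonic_position_def)
    moreover have "finite {card S | S. monophonic_position G S}"
    proof (rule finite_subset)
      show "{card S | S. monophonic_position G S} \<subseteq> {..card (verts G)}"
        by (auto simp: monophonic_position_def intro: card_mono finite_verts)
    qed simp
    ultimately have "card ?S \<le> mp_number G"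
      unfolding mp_number_def by (intro Max_ge) blast+
    then show False
      using card mp by simp
  qed
  then show thesis
    using that by blast
qed

lemma no_triangle:
  assumes "adj u v" "adj v w" "adj u w"
  shows False
proof -
  have "{u, v, w} \<subseteq> verts G"
    using assms by (auto dest: adj_verts)
  moreover have "distinct [u, v, w]"
    using assms by auto
  ultimately obtain p where p: "monophonic_path G p" "{u, v, w} \<subseteq> set p"
    by (rule triple_on_path)
  obtain i j k where "i < length p" "p ! i = u" "j < length p" "p ! j = v"
    "k < length p" "p ! k = w"
    using p(2) by (metis in_set_conv_nth insert_subset)
  then show False
    using assms monophonic_path_adj_iff[OF p(1), of i j] monophonic_path_adj_iff[OF p(1), of j k]
      monophonic_path_adj_iff[OF p(1), of i k] by auto
qed

lemma twins_dominate:
  assumes uv: "u \<in> verts G" "v \<in> verts G" "u \<noteq> v" "nbh u = nbh v"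
    and w: "w \<in> verts G" "w \<noteq> u" "w \<noteq> v"
  shows "adj u w"
proof -
  obtain p where p: "monophonic_path G p" "{u, v, w} \<subseteq> set p"
    by (rule triple_on_path[of u v w]) (use uv w in auto)
  obtain i j k where ijk: "i < length p" "p ! i = u" "j < length p" "p ! j = v"
    "k < length p" "p ! k = w"
    using p(2) by (metis in_set_conv_nth insert_subset)
  then have "i \<noteq> j" "k \<noteq> i" "k \<noteq> j"
    using uv w by auto
  moreover have "{i, j} = {0, 2} \<and> length p = 3"
    using monophonic_path_twins[OF p(1), of i j] monophonic_path_twins[OF p(1), of j i] uv(4) ijk
      \<open>i \<noteq> j\<close> by (cases i j rule: linorder_cases) auto
  ultimately have "k = Suc i \<or> i = Suc k"
    using ijk(5) by (auto simp: doubleton_eq_iff)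
  then show ?thesis
    using monophonic_path_adj_iff[OF p(1), of i k] ijk by simp
qed

lemma twin_free:
  assumes "u \<in> verts G" "v \<in> verts G" "nbh u = nbh v"
  shows "u = v"
proof (rule ccontr)
  assume "u \<noteq> v"
  let ?N = "verts G - {u, v}"
  have dom: "adj u w \<and> adj v w" if "w \<in> ?N" for w
    using twins_dominate[of u v w] that assms \<open>u \<noteq> v\<close> nbh_iff by auto
  have "card ?N \<ge> 3"
    using order assms \<open>u \<noteq> v\<close> by (simp add: card_Diff_subset)
  then obtain T where "T \<subseteq> ?N" "card T = 3"
    by (meson obtain_subset_with_card_n)
  then obtain x y z where xyz: "{x, y, z} \<subseteq> ?N" "distinct [x, y, z]"
    by (auto simp: card_3_iff)
  obtain p where p: "monophonic_path G p" "{x, y, z} \<subseteq> set p"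
    by (rule triple_on_path[of x y z]) (use xyz in auto)
  obtain w where w: "w \<in> set p" "adj x w"
    using monophonic_path_ex_adj[OF p(1), of x y] p(2) xyz(2) by auto
  have "w \<in> {u, v}"
    using dom no_triangle w(2) xyz(1) adj_verts by (metis Diff_iff insert_subset)
  then have "adj w x" "adj w y" "adj w z"
    using dom xyz(1) by auto
  then show False
    using monophonic_path_no_claw[OF p(1), of w x y z] p(2) w(1) xyz(2) by auto
qed

end

section \<open>Dense graphs contain no 5-cycle\<close>

locale dense_mp2_graph = mp2_graph +
  assumes dense: "(card (verts G) - 1)\<^sup>2 \<le> 4 * card (edges G)"
begin

definition cyc5 :: "'a \<Rightarrow> 'a \<Rightarrow> 'a \<Rightarrow> 'a \<Rightarrow> 'a \<Rightarrow> bool" where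
  "cyc5 a b c d e \<longleftrightarrow> adj a b \<and> adj b c \<and> adj c d \<and> adj d e \<and> adj e a"

definition is_C5 :: "'a set \<Rightarrow> bool" where
  "is_C5 C \<longleftrightarrow> (\<exists>a b c d e. C = {a, b, c, d, e} \<and> cyc5 a b c d e)"

lemma no_triangle': "adj u v \<Longrightarrow> adj v w \<Longrightarrow> \<not> adj u w"
  using no_triangle by blast

lemma cyc5_distinct:
  assumes "cyc5 a b c d e"
  shows "distinct [a, b, c, d, e]"
proof -
  have "u \<noteq> z" if "adj u v" "adj v w" "adj w z" for u v w z
    using no_triangle'[OF that(1,2)] that(3) adj_commute by blast
  then have "a \<noteq> d" "b \<noteq> e" "c \<noteq> a" "d \<noteq> b" "e \<noteq> c"
    using assms unfolding cyc5_def by blast+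
  moreover have "a \<noteq> b" "b \<noteq> c" "c \<noteq> d" "d \<noteq> e" "e \<noteq> a"
    using assms unfolding cyc5_def by auto
  ultimately show ?thesis
    by auto
qed

lemma cyc5_chordless:
  assumes "cyc5 a b c d e"
  shows "\<not> adj a c" "\<not> adj b d" "\<not> adj c e" "\<not> adj d a" "\<not> adj e b"
  using assms no_triangle' unfolding cyc5_def by blast+

lemma is_C5_card:
  assumes "is_C5 C"
  shows "card C = 5"
  using assms cyc5_distinct unfolding is_C5_def by force

lemma is_C5_subset:
  assumes "is_C5 C"
  shows "C \<subseteq> verts G"
  using assms adj_verts unfolding is_C5_def cyc5_def by blast

lemma card_edges_in_C5:
  assumes "is_C5 C"
  shows "card (edges_in C) \<le> 5"
proof -
  obtain a b c d e where C: "C = {a, b, c, d, e}" and cyc: "cyc5 a b c d e"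
    using assms unfolding is_C5_def by blast
  have ch: "\<not> adj a c" "\<not> adj b d" "\<not> adj c e" "\<not> adj d a" "\<not> adj e b"
    "\<not> adj c a" "\<not> adj d b" "\<not> adj e c" "\<not> adj a d" "\<not> adj b e"
    using cyc5_chordless[OF cyc] adj_commute by blast+
  have "edges_in C \<subseteq> {{a, b}, {b, c}, {c, d}, {d, e}, {e, a}}"
  proof
    fix f assume "f \<in> edges_in C"
    then obtain u v where "f = {u, v}" "adj u v" "u \<in> C" "v \<in> C"
      unfolding edges_in_def by (blast elim: edge_cases)
    then show "f \<in> {{a, b}, {b, c}, {c, d}, {d, e}, {e, a}}"
      using ch unfolding C by (elim insertE emptyE) (simp_all add: insert_commute)
  qed
  then have "card (edges_in C) \<le> card {{a, b}, {b, c}, {c, d}, {d, e}, {e, a}}"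
    by (intro card_mono) auto
  also have "\<dots> \<le> 5"
    using card_length[of "[{a, b}, {b, c}, {c, d}, {d, e}, {e, a}]"] by simp
  finally show ?thesis .
qed

lemma nbh_cyc5_cases:
  assumes cyc: "cyc5 a b c d e"
  shows "nbh x \<inter> {a, b, c, d, e} \<subseteq> {a, c} \<or> nbh x \<inter> {a, b, c, d, e} \<subseteq> {b, d} \<or>
    nbh x \<inter> {a, b, c, d, e} \<subseteq> {c, e} \<or> nbh x \<inter> {a, b, c, d, e} \<subseteq> {d, a} \<or>
    nbh x \<inter> {a, b, c, d, e} \<subseteq> {e, b}"
proof -
  have nots: "\<not> (adj x a \<and> adj x b)" "\<not> (adj x b \<and> adj x c)" "\<not> (adj x c \<and> adj x d)"
    "\<not> (adj x d \<and> adj x e)" "\<not> (adj x e \<and> adj x a)"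
    using cyc no_triangle' unfolding cyc5_def by blast+
  show ?thesis
    by (insert nots, cases "adj x a"; cases "adj x b"; cases "adj x c"; cases "adj x d"; cases "adj x e";
        simp add: nbh_iff Int_insert_right)
qed

lemma card_pair_le: "S \<subseteq> {u, v} \<Longrightarrow> card S \<le> 2"
  using card_mono[of "{u, v}" S] card_length[of "[u, v]"] by simp

lemma nbh_C5_le:
  assumes "is_C5 C"
  shows "card (nbh x \<inter> C) \<le> 2"
  using assms nbh_cyc5_cases[of _ _ _ _ _ x] card_pair_le unfolding is_C5_def by metis

lemma nbh_C5_2E:
  assumes "is_C5 C" "card (nbh x \<inter> C) = 2"
  obtains a b c d e where "C = {a, b, c, d, e}" "cyc5 a b c d e" "nbh x \<inter> C = {e, b}"
proof -
  obtain a b c d e where C: "C = {a, b, c, d, e}" and cyc: "cyc5 a b c d e"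
    using assms(1) unfolding is_C5_def by blast
  have eq: "nbh x \<inter> C = {u, v}" if "nbh x \<inter> C \<subseteq> {u, v}" for u v
  proof -
    have "card {u, v} \<le> card (nbh x \<inter> C)"
      using card_length[of "[u, v]"] assms(2) by simp
    then show ?thesis
      using card_seteq[of "{u, v}" "nbh x \<inter> C"] that by simp
  qed
  have rot: "cyc5 b c d e a" "cyc5 c d e a b" "cyc5 d e a b c" "cyc5 e a b c d"
    using cyc by (auto simp: cyc5_def)
  from nbh_cyc5_cases[OF cyc, of x, folded C] show thesis
  proof (elim disjE, goal_cases)
    case 1
    then show ?case
      using that[of b c d e a] rot cyc C eq[OF 1] by (simp add: insert_commute)
  next
    case 2
    then show ?case
      using that[of c d e a b] rot cyc C eq[OF 2] by (simp add: insert_commute)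
  next
    case 3
    then show ?case
      using that[of d e a b c] rot cyc C eq[OF 3] by (simp add: insert_commute)
  next
    case 4
    then show ?case
      using that[of e a b c d] rot cyc C eq[OF 4] by (simp add: insert_commute)
  next
    case 5
    then show ?case
      using that[of a b c d e] rot cyc C eq[OF 5] by (simp add: insert_commute)
  qed
qed

lemma deficiency_bound:
  assumes C: "is_C5 C"
  defines "X \<equiv> verts G - C"
  shows "(card X)\<^sup>2 + 4 * (\<Sum>x\<in>X. 2 - card (nbh x \<inter> C)) \<le> 4 * card (edges_in X) + 4"
proof -
  have fin: "finite X"
    by (simp add: X_def finite_verts)
  have verts: "X \<union> C = verts G"
    using is_C5_subset[OF C] by (auto simp: X_def)
  have n: "card (verts G) = card X + 5"
    using card_Un_disjoint[of X C] fin is_C5_card[OF C] verts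
    by (metis C Diff_disjoint X_def finite_Un finite_verts inf_commute)
  have "card (edges_in X) + card (edges_in C) + (\<Sum>x\<in>X. card (nbh x \<inter> C)) = card (edges G)"
    using card_edges_in_Un[OF fin, of C] verts edges_in_verts by (simp add: X_def Int_commute)
  moreover have "(\<Sum>x\<in>X. card (nbh x \<inter> C)) + (\<Sum>x\<in>X. 2 - card (nbh x \<inter> C)) = 2 * card X"
    using nbh_C5_le[OF C] by (simp add: sum.distrib[symmetric])
  moreover have "(card X + 4)\<^sup>2 \<le> 4 * card (edges G)"
    using dense n by (simp add: add.commute)
  moreover have "(card X + 4)\<^sup>2 = (card X)\<^sup>2 + 8 * card X + 16"
    by (simp add: power2_eq_square algebra_simps)
  ultimately show ?thesis
    using card_edges_in_C5[OF C] by linarith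
qed

lemma deficiency_le_1:
  assumes C: "is_C5 C"
  shows "(\<Sum>x\<in>verts G - C. 2 - card (nbh x \<inter> C)) \<le> 1"
proof -
  have "4 * card (edges_in (verts G - C)) \<le> (card (verts G - C))\<^sup>2"
    by (rule mantel) (use finite_verts no_triangle in blast)+
  then show ?thesis
    using deficiency_bound[OF C] by linarith
qed

lemma deficiency_single:
  assumes "is_C5 C" "x \<in> verts G - C"
  shows "card (nbh x \<inter> C) \<ge> 1"
proof -
  have "(\<Sum>x\<in>{x}. 2 - card (nbh x \<inter> C)) \<le> (\<Sum>x\<in>verts G - C. 2 - card (nbh x \<inter> C))"
    by (rule sum_mono2) (use assms finite_verts in auto)
  then show ?thesis
    using deficiency_le_1[OF assms(1)] by simp
qed

lemma deficiency_pair: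
  assumes "is_C5 C" "x \<in> verts G - C" "y \<in> verts G - C" "x \<noteq> y"
  shows "card (nbh x \<inter> C) + card (nbh y \<inter> C) \<ge> 3"
proof -
  have "(\<Sum>x\<in>{x, y}. 2 - card (nbh x \<inter> C)) \<le> (\<Sum>x\<in>verts G - C. 2 - card (nbh x \<inter> C))"
    by (rule sum_mono2) (use assms finite_verts in auto)
  then show ?thesis
    using deficiency_le_1[OF assms(1)] assms(4) by simp
qed

lemma cyc5_swap:
  assumes "cyc5 a b c d e" "nbh x \<inter> {a, b, c, d, e} = {e, b}"
  shows "is_C5 {x, b, c, d, e}"
proof -
  have "adj x b" "adj x e"
    using assms(2) by (auto simp: nbh_iff)
  then show ?thesis
    using assms(1) unfolding is_C5_def cyc5_def by (metis adj_commute)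
qed

lemma card_nbh_swap:
  assumes "a \<notin> S" "x \<notin> S" "finite S"
  shows "card (nbh z \<inter> insert x S) + (if adj z a then 1 else 0) =
    card (nbh z \<inter> insert a S) + (if adj z x then 1 else 0)"
  using assms by (simp add: Int_insert_right nbh_iff)

lemma swap_witness:
  assumes cyc: "cyc5 a b c d e" and C: "C = {a, b, c, d, e}"
    and x: "x \<in> verts G - C" "nbh x \<inter> C = {e, b}"
  defines "C' \<equiv> {x, b, c, d, e}"
  obtains z where "adj z x" "\<not> adj z a" "z \<in> verts G - C"
      "card (nbh z \<inter> C') = Suc (card (nbh z \<inter> C))"
  | z where "adj z a" "\<not> adj z x" "z \<in> verts G - C" "z \<in> verts G - C'"
      "card (nbh z \<inter> C) = Suc (card (nbh z \<inter> C'))"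
proof -
  have dist: "distinct [x, a, b, c, d, e]"
    using cyc5_distinct[OF cyc] x(1) C by auto
  have swap: "card (nbh z \<inter> C') + (if adj z a then 1 else 0) =
      card (nbh z \<inter> C) + (if adj z x then 1 else 0)" for z
    unfolding C C'_def by (rule card_nbh_swap) (use dist in auto)
  have a: "adj a b" "adj a e" "\<not> adj a c" "\<not> adj a d"
    using cyc cyc5_chordless[OF cyc] adj_commute by (auto simp: cyc5_def)
  have xs: "adj x b" "adj x e"
    using x(2) by (auto simp: nbh_iff)
  then have xa: "\<not> adj a x"
    using a no_triangle' by blast
  have "nbh x \<noteq> nbh a"
    using twin_free[of x a] x(1) adj_verts[OF a(1)] dist by auto
  then consider z where "adj x z" "\<not> adj a z" | z where "adj a z" "\<not> adj x z"
    by (auto simp: nbh_def)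
  then show thesis
  proof cases
    case (1 z)
    then have "z \<notin> C"
      using x(2) a by (auto simp: nbh_iff)
    then show ?thesis
      using that(1)[of z] 1 swap[of z] adj_verts[OF 1(1)] by (simp add: adj_commute)
  next
    case (2 z)
    then have "z \<notin> C" "z \<notin> C'"
      using a xs xa by (auto simp: C C'_def)
    then show ?thesis
      using that(2)[of z] 2 swap[of z] adj_verts[OF 2(1)] by (simp add: adj_commute)
  qed
qed

lemma ex_deficient:
  assumes "is_C5 C"
  shows "\<exists>C y. is_C5 C \<and> y \<in> verts G - C \<and> card (nbh y \<inter> C) \<le> 1"
proof -
  have "\<not> verts G \<subseteq> C"
    using order is_C5_card[OF assms] card_mono[of C "verts G"] card.infinite[of C] by fastforce
  then obtain x where x: "x \<in> verts G - C"
    by blast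
  show ?thesis
  proof (cases "card (nbh x \<inter> C) = 2")
    case False
    then show ?thesis
      using nbh_C5_le[OF assms, of x] assms x by (intro exI[of _ C] exI[of _ x]) simp
  next
    case True
    then obtain a b c d e where C: "C = {a, b, c, d, e}" "cyc5 a b c d e" "nbh x \<inter> C = {e, b}"
      using nbh_C5_2E[OF assms] by metis
    have C': "is_C5 {x, b, c, d, e}"
      using cyc5_swap C by blast
    show ?thesis
    proof (rule swap_witness[OF C(2,1) x C(3)])
      fix z assume "z \<in> verts G - C" "card (nbh z \<inter> {x, b, c, d, e}) = Suc (card (nbh z \<inter> C))"
      then show ?thesis
        using assms nbh_C5_le[OF C', of z] by (intro exI[of _ C] exI[of _ z]) simp
    next
      fix z assume "z \<in> verts G - {x, b, c, d, e}"
        "card (nbh z \<inter> C) = Suc (card (nbh z \<inter> {x, b, c, d, e}))"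
      then show ?thesis
        using C' nbh_C5_le[OF assms, of z] by (intro exI[of _ "{x, b, c, d, e}"] exI[of _ z]) simp
    qed
  qed
qed

lemma deficient_adj:
  assumes "is_C5 C" and y: "y \<in> verts G - C" "card (nbh y \<inter> C) \<le> 1"
    and x: "x \<in> verts G - C" "x \<noteq> y"
    and C: "C = {a, b, c, d, e}" "cyc5 a b c d e" "nbh x \<inter> C = {e, b}"
  shows "adj y x \<and> \<not> adj y a"
proof (rule swap_witness[OF C(2,1) x(1) C(3)])
  let ?C' = "{x, b, c, d, e}"
  have C': "is_C5 ?C'"
    using cyc5_swap C by blast
  {
    fix z assume z: "adj z x" "\<not> adj z a" "z \<in> verts G - C"
      "card (nbh z \<inter> ?C') = Suc (card (nbh z \<inter> C))"
    have "z = y"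
      using deficiency_pair[OF assms(1) z(3) y(1)] y(2) z(4) nbh_C5_le[OF C', of z] by linarith
    then show ?thesis
      using z by simp
  next
    fix z assume z: "adj z a" "\<not> adj z x" "z \<in> verts G - C" "z \<in> verts G - ?C'"
      "card (nbh z \<inter> C) = Suc (card (nbh z \<inter> ?C'))"
    have "z \<noteq> y"
      using deficiency_single[OF C' z(4)] y(2) z(5) by auto
    moreover have "y \<in> verts G - ?C'"
      using y(1) x(2) C(1) by auto
    ultimately have "card (nbh y \<inter> ?C') > card (nbh y \<inter> C)"
      using deficiency_pair[OF C' z(4)] nbh_C5_le[OF assms(1), of z] y(2) z(5) by fastforce
    moreover have "card (nbh y \<inter> ?C') + (if adj y a then 1 else 0) =
        card (nbh y \<inter> C) + (if adj y x then 1 else 0)"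
      unfolding C(1) by (rule card_nbh_swap) (use cyc5_distinct[OF C(2)] x(1) C(1) in auto)
    ultimately show ?thesis
      by (auto split: if_splits)
  }
qed

lemma seven_vertices:
  assumes cyc: "cyc5 a b c d e" and verts: "verts G = {a, b, c, d, e, x, y}"
    and x: "x \<notin> {a, b, c, d, e}" "adj x e" "adj x b" and y: "adj y x" "\<not> adj y a" "\<not> adj y d"
  shows False
proof -
  have dist: "distinct [a, b, c, d, e]" and ch: "\<not> adj a c" "\<not> adj a d" "\<not> adj b d"
    and adj: "adj a b" "adj b c" "adj c d" "adj d e" "adj e a"
    using cyc5_distinct[OF cyc] cyc5_chordless[OF cyc] cyc adj_commute by (auto simp: cyc5_def)
  have nax: "\<not> adj a x" "\<not> adj d x"
    using adj x no_triangle' adj_commute by metis+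
  obtain p where p: "monophonic_path G p" "{a, x, d} \<subseteq> set p"
    by (rule triple_on_path[of a x d]) (use verts dist x in auto)
  have sub: "set p \<subseteq> {a, b, c, d, e, x, y}"
    using p(1) verts by (simp add: monophonic_path_def path_def)
  have "e \<notin> set p"
    using monophonic_path_no_claw[OF p(1), of e a x d] p(2) adj x dist by (auto simp: adj_commute)
  moreover obtain w where "w \<in> set p" "adj a w"
    using monophonic_path_ex_adj[OF p(1), of a x] p(2) x by auto
  ultimately have "b \<in> set p"
    using sub ch nax y(2) by (auto simp: adj_commute)
  then have "c \<notin> set p"
    using monophonic_path_no_claw[OF p(1), of b a x c] p(2) adj x dist by (auto simp: adj_commute)
  moreover obtain w where "w \<in> set p" "adj d w"
    using monophonic_path_ex_adj[OF p(1), of d x] p(2) x by auto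
  ultimately show False
    using sub ch nax y(3) \<open>e \<notin> set p\<close> by (auto simp: adj_commute)
qed

lemma no_C5: "\<not> is_C5 C"
proof
  assume "is_C5 C"
  then obtain C y where C5: "is_C5 C" and y: "y \<in> verts G - C" "card (nbh y \<inter> C) \<le> 1"
    using ex_deficient by blast
  let ?X = "verts G - C"
  have two: "card (nbh x \<inter> C) = 2" if "x \<in> ?X" "x \<noteq> y" for x
    using deficiency_pair[OF C5 that(1) y(1) that(2)] nbh_C5_le[OF C5, of x] y(2) by linarith
  have star: "adj y x" if "x \<in> ?X" "x \<noteq> y" for x
    using nbh_C5_2E[OF C5 two[OF that]] deficient_adj[OF C5 y that] by metis
  have "card (edges_in ({y} \<union> (?X - {y}))) + card (edges_in {y})
      = (\<Sum>x\<in>{y}. card (nbh x \<inter> ({y} \<union> (?X - {y}))))"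
    by (rule card_edges_in_cover) (use star no_triangle in \<open>simp, simp, blast\<close>)
  moreover have "{y} \<union> (?X - {y}) = ?X"
    using y(1) by auto
  ultimately have "card (edges_in ?X) \<le> card (nbh y \<inter> ?X)"
    by simp
  also have "\<dots> \<le> card (?X - {y})"
    by (rule card_mono) (auto simp: nbh_iff finite_verts)
  finally have "card (edges_in ?X) \<le> card ?X - 1" "card ?X \<ge> 1"
    using y(1) finite_verts by (auto simp: Suc_le_eq card_gt_0_iff)
  moreover have "(\<Sum>x\<in>{y}. 2 - card (nbh x \<inter> C)) \<le> (\<Sum>x\<in>?X. 2 - card (nbh x \<inter> C))"
    by (rule sum_mono2) (use y(1) finite_verts in auto)
  ultimately have "(card ?X)\<^sup>2 + 4 \<le> 4 * card ?X"
    using deficiency_bound[OF C5] y(2) by simp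
  then have "int ((card ?X)\<^sup>2 + 4) \<le> int (4 * card ?X)"
    by (rule of_nat_mono)
  then have "(int (card ?X) - 2)\<^sup>2 \<le> 0"
    by (simp add: power2_eq_square algebra_simps)
  then have "card ?X = 2"
    by simp
  then have "card (?X - {y}) = 1"
    using y(1) by simp
  then obtain x where "?X - {y} = {x}"
    by (rule card_1_singletonE)
  then have X: "?X = {x, y}" and "x \<noteq> y"
    using y(1) by blast+
  have x: "x \<in> ?X" "x \<noteq> y"
    using X \<open>x \<noteq> y\<close> by auto
  obtain a b c d e where C: "C = {a, b, c, d, e}" "cyc5 a b c d e" "nbh x \<inter> C = {e, b}"
    using nbh_C5_2E[OF C5 two[OF x]] by metis
  have xy: "adj y x" "\<not> adj y a"
    using deficient_adj[OF C5 y x C] by auto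
  have verts: "verts G = {a, b, c, d, e, x, y}"
    using X C(1) is_C5_subset[OF C5] by auto
  have xs: "adj x e" "adj x b" "x \<notin> {a, b, c, d, e}"
    using equalityD2[OF C(3)] x C(1) by (simp_all add: nbh_iff)
  show False
  proof (cases "adj y d")
    case False
    then show ?thesis
      using seven_vertices[OF C(2) verts xs(3,1,2) xy] by simp
  next
    case True
    then have "\<not> adj y c"
      using C(2) no_triangle' by (auto simp: cyc5_def adj_commute)
    moreover have "cyc5 a e d c b"
      using C(2) by (simp add: cyc5_def adj_commute)
    moreover have "verts G = {a, e, d, c, b, x, y}" "x \<notin> {a, e, d, c, b}"
      using verts xs by auto
    ultimately show ?thesis
      using seven_vertices[of a e d c b x y] xs xy by blast
  qed
qed

end

section \<open>Dense graphs are bipartite\<close>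

context dense_mp2_graph
begin

lemma bipartition:
  obtains A B where "A \<union> B = verts G" "A \<inter> B = {}"
    "\<And>u v. u \<in> A \<Longrightarrow> v \<in> A \<Longrightarrow> \<not> adj u v" "\<And>u v. u \<in> B \<Longrightarrow> v \<in> B \<Longrightarrow> \<not> adj u v"
proof -
  let ?V = "verts G"
  let ?d = "\<lambda>x. card (nbh x)"
  define D where "D = Max (?d ` ?V)"
  have le: "?d x \<le> D" if "x \<in> ?V" for x
    unfolding D_def using finite_verts that by simp
  have "D \<in> ?d ` ?V"
    unfolding D_def by (rule Max_in) (use finite_verts order in auto)
  then obtain v where v: "v \<in> ?V" "?d v = D"
    by blast
  define A where "A = nbh v"
  define B where "B = (\<Union>p\<in>A. nbh p)"
  define R where "R = ?V - A - B"
  have finA: "finite A" "A \<subseteq> ?V" "card A = D"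
    using nbh_subset v by (auto simp: A_def)
  have indep_A: "\<not> adj x y" if "x \<in> A" "y \<in> A" for x y
    using that no_triangle[of v x y] by (auto simp: A_def nbh_iff)
  then have disj: "A \<inter> B = {}"
    by (auto simp: B_def nbh_iff)
  have indep_B: "\<not> adj x y" if xy: "x \<in> B" "y \<in> B" for x y
  proof
    assume adj: "adj x y"
    obtain p q where pq: "adj v p" "adj p x" "adj v q" "adj q y"
      using xy by (auto simp: A_def B_def nbh_iff)
    then have "cyc5 v p x y q"
      using adj adj_commute by (auto simp: cyc5_def)
    then show False
      using no_C5 unfolding is_C5_def by blast
  qed
  have "\<not> adj a b" if ab: "a \<in> R" "b \<in> R" for a b
  proof
    assume adj: "adj a b"
    have "b \<in> nbh a"
      using adj by (simp add: nbh_iff)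
    then have "card (nbh a) > 0"
      by (auto simp: card_gt_0_iff)
    then have "D \<ge> 1"
      using le[of a] adj_verts(1)[OF adj] by simp
    then have "v \<in> B"
      using v by (auto simp: A_def B_def nbh_iff adj_commute card_gt_0_iff Suc_le_eq)
    have nA: "nbh x \<subseteq> ?V - A - {v}" if "x \<in> R" for x
      using that nbh_subset[of x] by (auto simp: R_def B_def A_def nbh_iff adj_commute)
    have neq: "a \<noteq> b" "a \<noteq> v" "b \<noteq> v" "v \<notin> A" "a \<in> ?V - A" "b \<in> ?V - A"
      using ab adj \<open>v \<in> B\<close> disj by (auto simp: R_def)
    let ?C = "?V - A"
    let ?n = "card ?V"
    have cardC: "card ?C = ?n - D" "D \<le> ?n"
      using finA finite_verts by (auto simp: card_Diff_subset card_mono)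
    have card3: "card ?C \<ge> 3"
      using card_mono[of ?C "{a, b, v}"] neq v(1) finite_verts by simp
    have "card (edges_in (?C \<union> A)) + card (edges_in ?C) = (\<Sum>x\<in>?C. card (nbh x \<inter> (?C \<union> A)))"
      by (rule card_edges_in_cover) (use finite_verts indep_A in auto)
    moreover have CA: "?C \<union> A = ?V"
      using finA by auto
    moreover have "nbh x \<inter> ?V = nbh x" for x
      using nbh_subset by blast
    ultimately have "card (edges G) + card (edges_in ?C) = (\<Sum>x\<in>?C. ?d x)"
      by (simp add: edges_in_verts)
    also have "\<dots> = ?d a + (?d b + (\<Sum>x\<in>?C - {a} - {b}. ?d x))"
      using neq finite_verts by (subst sum.remove[of _ a], simp, simp, subst sum.remove[of _ b]) auto
    finally have edges: "card (edges G) + card (edges_in ?C)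
        = ?d a + (?d b + (\<Sum>x\<in>?C - {a} - {b}. ?d x))" .
    have "(\<Sum>x\<in>?C - {a} - {b}. ?d x) \<le> (\<Sum>x\<in>?C - {a} - {b}. D)"
      by (rule sum_mono) (simp add: le)
    also have "\<dots> = (card ?C - 2) * D"
      using neq finite_verts by (simp add: numeral_2_eq_2)
    finally have rest: "(\<Sum>x\<in>?C - {a} - {b}. ?d x) \<le> (card ?C - 2) * D" .
    have "nbh a \<inter> nbh b = {}"
      using adj no_triangle by (auto simp: nbh_iff)
    then have "?d a + ?d b = card (nbh a \<union> nbh b)"
      by (simp add: card_Un_disjoint)
    also have "\<dots> \<le> card (?C - {v})"
      by (rule card_mono) (use nA ab finite_verts in auto)
    also have "\<dots> = card ?C - 1"
      using v(1) neq finite_verts by simp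
    finally have ends: "?d a + ?d b \<le> card ?C - 1" .
    obtain p where p: "monophonic_path G p" "{a, b, v} \<subseteq> set p"
      by (rule triple_on_path[of a b v]) (use neq v(1) in auto)
    obtain f where f: "f \<in> edges_in ?C" "f \<noteq> {a, b}"
    proof (cases "nbh a = {b} \<and> nbh b = {a}")
      case True
      then have only: "adj a x \<longleftrightarrow> x = b" "adj b x \<longleftrightarrow> x = a" for x
        using nbh_iff by blast+
      obtain i j k where ijk: "i < length p" "p ! i = a" "j < length p" "p ! j = b"
        "k < length p" "p ! k = v"
        using p(2) by (metis in_set_conv_nth insert_subset)
      have "distinct p"
        using p(1) by (simp add: monophonic_path_def path_def)
      then have i: "l = j" if "l < length p" "l = Suc i \<or> i = Suc l" for l
        using monophonic_path_adj_iff[OF p(1), of i l] only(1) ijk that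
          nth_eq_iff_index_eq[OF \<open>distinct p\<close>, of l j] by auto
      have j: "l = i" if "l < length p" "l = Suc j \<or> j = Suc l" for l
        using monophonic_path_adj_iff[OF p(1), of j l] only(2) ijk that
          nth_eq_iff_index_eq[OF \<open>distinct p\<close>, of l i] by auto
      have "k \<noteq> i" "k \<noteq> j"
        using ijk neq by auto
      have "j = Suc i \<or> i = Suc j"
        using monophonic_path_adj_iff[OF p(1), of i j] adj ijk by simp
      then have False
      proof
        assume "j = Suc i"
        then have "i = 0" "\<not> Suc j < length p"
          using i[of "i - 1"] j[of "Suc j"] ijk(1) by (cases i; auto)+
        then show False
          using \<open>j = Suc i\<close> \<open>k \<noteq> i\<close> \<open>k \<noteq> j\<close> ijk(5) by linarith
      next
        assume "i = Suc j"
        then have "j = 0" "\<not> Suc i < length p"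
          using j[of "j - 1"] i[of "Suc i"] ijk(3) by (cases j; auto)+
        then show False
          using \<open>i = Suc j\<close> \<open>k \<noteq> i\<close> \<open>k \<noteq> j\<close> ijk(5) by linarith
      qed
      then show ?thesis ..
    next
      case False
      have "\<exists>x\<in>{a, b}. \<exists>y. adj x y \<and> y \<notin> {a, b}"
      proof (rule ccontr)
        assume "\<not> ?thesis"
        then have "nbh a = {b}" "nbh b = {a}"
          using adj adj_commute[of a b] by (auto simp: nbh_iff)
        with False show False
          by simp
      qed
      then obtain x y where "x \<in> {a, b}" "adj x y" "y \<notin> {a, b}"
        by blast
      then show ?thesis
        using that[of "{x, y}"] nA ab neq by (auto simp: edges_in_def adj_def nbh_def doubleton_eq_iff)
    qed
    have "{f, {a, b}} \<subseteq> edges_in ?C"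
      using f adj neq by (auto simp: edges_in_def adj_def)
    then have "card (edges_in ?C) \<ge> 2"
      using f(2) card_mono[of "edges_in ?C" "{f, {a, b}}"] by simp
    then have "card (edges G) + 2 \<le> card ?C - 1 + (card ?C - 2) * D"
      using edges rest ends by linarith
    moreover obtain m where m: "card ?C = m + 3"
      using card3 by (metis add.commute le_iff_add)
    moreover have "?n = D + (m + 3)"
      using cardC m by simp
    ultimately have "card (edges G) \<le> m + (m + 1) * D" and "(D + m + 2)\<^sup>2 \<le> 4 * card (edges G)"
      using dense by (simp_all add: algebra_simps)
    then have "(D + m + 2)\<^sup>2 \<le> 4 * (m + (m + 1) * D)"
      by (meson le_trans mult_le_mono2)
    then have "int ((D + m + 2)\<^sup>2) \<le> int (4 * (m + (m + 1) * D))"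
      by (rule of_nat_mono)
    then have "(int D + int m + 2)\<^sup>2 \<le> 4 * (int m + (int m + 1) * int D)"
      by (simp only: of_nat_add of_nat_mult of_nat_power of_nat_numeral of_nat_1)
    moreover have "4 * (int m + (int m + 1) * int D) = (int D + int m + 2)\<^sup>2 - (int D - int m)\<^sup>2 - 4"
      by (simp add: power2_eq_square algebra_simps)
    ultimately show False
      using zero_le_power2[of "int D - int m"] by linarith
  qed
  moreover have "\<not> adj x y" if "x \<in> A" "y \<in> R" for x y
    using that by (auto simp: R_def B_def nbh_iff)
  ultimately have "\<not> adj x y" if "x \<in> A \<union> R" "y \<in> A \<union> R" for x y
    using that indep_A adj_commute by blast
  moreover have "B \<subseteq> ?V"
    using nbh_subset by (auto simp: B_def)
  then have "(A \<union> R) \<union> B = ?V" "(A \<union> R) \<inter> B = {}"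
    using finA disj by (auto simp: R_def)
  ultimately show thesis
    using that[of "A \<union> R" B] indep_B by blast
qed

end

section \<open>Bipartite complements of matchings\<close>

lemma card_bipartite_edges:
  assumes "finite A" "finite B" "A \<inter> B = {}" "M \<subseteq> A \<times> B"
  shows "card ((\<lambda>(x, y). {x, y}) ` (A \<times> B - M)) + card M = card A * card B"
proof -
  have fin: "finite (A \<times> B)"
    using assms by simp
  have "card ((\<lambda>(x, y). {x, y}) ` (A \<times> B - M)) = card (A \<times> B - M)"
    by (rule card_image) (use assms(3) in \<open>auto simp: inj_on_def doubleton_eq_iff\<close>)
  also have "\<dots> = card (A \<times> B) - card M"
    using assms(4) finite_subset[OF assms(4) fin] by (simp add: card_Diff_subset)
  finally show ?thesis
    using card_mono[OF fin assms(4)] by (simp add: card_cartesian_product)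
qed

locale comatching_graph =
  fixes G :: "'a graph" and A B :: "'a set" and M :: "('a \<times> 'a) set"
  assumes finite_A: "finite A" and finite_B: "finite B" and disjoint: "A \<inter> B = {}"
    and verts: "verts G = A \<union> B"
    and M: "M \<subseteq> A \<times> B" "inj_on fst M" "inj_on snd M"
    and edges: "edges G = (\<lambda>(x, y). {x, y}) ` (A \<times> B - M)"
begin

lemma swap: "comatching_graph G B A (prod.swap ` M)"
proof
  have "(\<lambda>(x, y). {x, y}) ` (B \<times> A - prod.swap ` M) = (\<lambda>(x, y). {x, y}) ` prod.swap ` (A \<times> B - M)"
    by (simp add: image_set_diff product_swap)
  also have "\<dots> = (\<lambda>(x, y). {x, y}) ` (A \<times> B - M)"
    unfolding image_image by (rule image_cong) auto
  finally show "edges G = (\<lambda>(x, y). {x, y}) ` (B \<times> A - prod.swap ` M)"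
    using edges by simp
qed (use finite_A finite_B disjoint verts M in \<open>auto simp: inj_on_def\<close>)

lemma edge_iff: "x \<in> A \<Longrightarrow> y \<in> B \<Longrightarrow> {x, y} \<in> edges G \<longleftrightarrow> (x, y) \<notin> M"
  using disjoint edges by (auto simp: image_iff doubleton_eq_iff)

lemma no_edge_A: "x \<in> A \<Longrightarrow> y \<in> A \<Longrightarrow> {x, y} \<notin> edges G"
  using disjoint edges by (auto simp: doubleton_eq_iff)

lemma no_edge_B: "x \<in> B \<Longrightarrow> y \<in> B \<Longrightarrow> {x, y} \<notin> edges G"
  using disjoint edges by (auto simp: doubleton_eq_iff)

lemma simple: "simple_graph G"
  using disjoint edges finite_A finite_B verts by (auto simp: simple_graph_def card_insert_if)

lemma order: "graph_order G = card A + card B"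
  using finite_A finite_B disjoint by (simp add: graph_order_def verts card_Un_disjoint)

lemma finite_M: "finite M"
  using M(1) finite_A finite_B finite_subset by blast

lemma size: "graph_size G + card M = card A * card B"
  using card_bipartite_edges[OF finite_A finite_B disjoint M(1)] by (simp add: graph_size_def edges)

lemma M_unique: "(x, y) \<in> M \<Longrightarrow> (x, y') \<in> M \<Longrightarrow> y = y'" "(x, y) \<in> M \<Longrightarrow> (x', y) \<in> M \<Longrightarrow> x = x'"
  using inj_onD[OF M(2), of "(x, y)" "(x, y')"] inj_onD[OF M(3), of "(x, y)" "(x', y)"] by auto

lemma card_unmatched: "card (A - fst ` M) + card M = card A"
proof -
  have "card (A - fst ` M) = card A - card (fst ` M)"
    by (rule card_Diff_subset) (use finite_M M(1) in auto)
  moreover have "card (fst ` M) \<le> card A"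
    by (rule card_mono) (use finite_A M(1) in auto)
  ultimately show ?thesis
    using card_image[OF M(2)] by simp
qed

lemma monophonic_path3:
  assumes "x \<in> A" "x' \<in> A" "x \<noteq> x'" "y \<in> B" "(x, y) \<notin> M" "(x', y) \<notin> M"
  shows "monophonic_path G [x, y, x']"
  using assms edge_iff[of x y] edge_iff[of x' y] no_edge_A[of x x'] disjoint verts
  by (auto simp: monophonic_path_def path_def less_Suc_eq nth_Cons insert_commute split: nat.splits)

lemma monophonic_path4:
  assumes "x \<in> A" "x' \<in> A" "x \<noteq> x'" "y \<in> B" "y' \<in> B" "y \<noteq> y'"
    "(x, y) \<notin> M" "(x', y) \<notin> M" "(x', y') \<notin> M" "(x, y') \<in> M"
  shows "monophonic_path G [x, y, x', y']"
  using assms edge_iff[of x y] edge_iff[of x' y] edge_iff[of x' y'] edge_iff[of x y']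
    no_edge_A[of x x'] no_edge_B[of y y'] disjoint verts
  by (auto simp: monophonic_path_def path_def less_Suc_eq nth_Cons insert_commute split: nat.splits)

lemma monophonic_path5:
  assumes "{x, x', x''} \<subseteq> A" "distinct [x, x', x'']" "(x, y) \<in> M" "(x'', y'') \<in> M"
  shows "monophonic_path G [x, y'', x', y, x'']"
proof -
  have "y \<in> B" "y'' \<in> B" "y \<noteq> y''"
    using assms M M_unique by auto
  moreover have "(x, y'') \<notin> M" "(x', y) \<notin> M" "(x', y'') \<notin> M" "(x'', y) \<notin> M"
    using assms M_unique by auto
  ultimately show ?thesis
    using assms edge_iff[of x y] edge_iff[of x y''] edge_iff[of x' y] edge_iff[of x' y'']
      edge_iff[of x'' y] edge_iff[of x'' y'']
      no_edge_A[of x x'] no_edge_A[of x x''] no_edge_A[of x' x''] no_edge_B[of y y''] disjoint verts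
    by (auto simp: monophonic_path_def path_def less_Suc_eq nth_Cons insert_commute split: nat.splits)
qed

lemma triple_AAA_on_path:
  assumes "card A \<le> card M + 1" "{u, v, w} \<subseteq> A" "distinct [u, v, w]"
  shows "\<exists>p. monophonic_path G p \<and> {u, v, w} \<subseteq> set p"
proof -
  have "card (A - fst ` M) \<le> 1"
    using assms(1) card_unmatched by simp
  then have le1: "x = y" if "x \<in> A - fst ` M" "y \<in> A - fst ` M" for x y
    using that card_le_Suc0_iff_eq[of "A - fst ` M"] finite_A by auto
  have path: "\<exists>p. monophonic_path G p \<and> {x, y, z} \<subseteq> set p"
    if xyz: "{x, y, z} \<subseteq> A" "distinct [x, y, z]" and xz: "x \<in> fst ` M" "z \<in> fst ` M" for x y z
  proof -
    obtain x' z' where "(x, x') \<in> M" "(z, z') \<in> M"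
      using xz by auto
    then show ?thesis
      using monophonic_path5[OF xyz] by (intro exI[of _ "[x, z', y, x', z]"]) auto
  qed
  consider "u \<in> fst ` M" "w \<in> fst ` M" | "u \<in> fst ` M" "v \<in> fst ` M" | "v \<in> fst ` M" "w \<in> fst ` M"
    using le1[of u v] le1[of u w] le1[of v w] assms(2,3) by auto
  then show ?thesis
  proof cases
    case 1
    then show ?thesis using path[of u v w] assms by auto
  next
    case 2
    then show ?thesis using path[of u w v] assms by (auto simp: insert_commute)
  next
    case 3
    then show ?thesis using path[of v u w] assms by (auto simp: insert_commute)
  qed
qed

lemma triple_AAB_on_path:
  assumes "card B \<ge> 3" "u \<in> A" "v \<in> A" "u \<noteq> v" "w \<in> B"
  shows "\<exists>p. monophonic_path G p \<and> {u, v, w} \<subseteq> set p"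
proof -
  have path: "\<exists>p. monophonic_path G p \<and> {x, y, w} \<subseteq> set p"
    if xy: "x \<in> A" "y \<in> A" "x \<noteq> y" "(x, w) \<in> M" for x y
  proof -
    have "\<not> B \<subseteq> {w, SOME z. (y, z) \<in> M}"
    proof
      assume "B \<subseteq> {w, SOME z. (y, z) \<in> M}"
      then have "card B \<le> card {w, SOME z. (y, z) \<in> M}"
        by (rule card_mono[rotated]) simp
      also have "\<dots> \<le> 2"
        using card_length[of "[w, SOME z. (y, z) \<in> M]"] by simp
      finally show False
        using assms(1) by simp
    qed
    then obtain z where z: "z \<in> B" "z \<noteq> w" "z \<noteq> (SOME z. (y, z) \<in> M)"
      by blast
    then have "(y, z) \<notin> M"
      using someI[of "\<lambda>z. (y, z) \<in> M" z] M_unique(1) by blast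
    moreover have "(x, z) \<notin> M" "(y, w) \<notin> M"
      using xy z M_unique by blast+
    ultimately show ?thesis
      using monophonic_path4[of x y z w] xy z assms(5) by (intro exI[of _ "[x, z, y, w]"]) auto
  qed
  consider "(u, w) \<in> M" | "(v, w) \<in> M" | "(u, w) \<notin> M" "(v, w) \<notin> M"
    by blast
  then show ?thesis
  proof cases
    case 1
    then show ?thesis using path[of u v] assms by simp
  next
    case 2
    then show ?thesis using path[of v u] assms by (simp add: conj_commute conj_left_commute)
  next
    case 3
    then show ?thesis
      using monophonic_path3[of u v w] assms by (intro exI[of _ "[u, w, v]"]) auto
  qed
qed

end

lemma mp_number_eq_2I:
  assumes fin: "finite (verts G)" and card: "card (verts G) \<ge> 2"
    and triple: "\<And>u v w. {u, v, w} \<subseteq> verts G \<Longrightarrow> distinct [u, v, w] \<Longrightarrow>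
      \<exists>p. monophonic_path G p \<and> {u, v, w} \<subseteq> set p"
  shows "mp_number G = 2"
  unfolding mp_number_def
proof (rule Max_eqI)
  have le: "card S \<le> 2" if S: "monophonic_position G S" for S
  proof (rule ccontr)
    assume "\<not> card S \<le> 2"
    then obtain T where T: "T \<subseteq> S" "card T = 3"
      using obtain_subset_with_card_n[of 3 S] by auto
    then obtain u v w where uvw: "T = {u, v, w}" "distinct [u, v, w]"
      by (auto simp: card_3_iff)
    then obtain p where p: "monophonic_path G p" "T \<subseteq> set p"
      using triple[of u v w] S T by (auto simp: monophonic_position_def)
    have "card T \<le> card (S \<inter> set p)"
      by (rule card_mono) (use T p in auto)
    then show False
      using S p(1) T(2) by (fastforce simp: monophonic_position_def)
  qed
  then show "y \<le> 2" if "y \<in> {card S |S. monophonic_position G S}" for y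
    using that by blast
  then show "finite {card S |S. monophonic_position G S}"
    by (meson finite_nat_set_iff_bounded_le)
  obtain S where S: "S \<subseteq> verts G" "card S = 2" "finite S"
    using obtain_subset_with_card_n[OF card] by metis
  then have "monophonic_position G S"
    by (metis monophonic_position_def card_mono Int_lower1)
  then show "2 \<in> {card S |S. monophonic_position G S}"
    using S by (metis (mono_tags, lifting) mem_Collect_eq)
qed

lemma (in comatching_graph) mp_number:
  assumes "card A \<ge> 3" "card B \<ge> 3" "card A \<le> card M + 1" "card B \<le> card M + 1"
  shows "mp_number G = 2"
proof (rule mp_number_eq_2I)
  show "finite (verts G)"
    using simple by (simp add: simple_graph_def)
  show "card (verts G) \<ge> 2"
    using order assms by (simp add: graph_order_def)
  fix u v w assume uvw: "{u, v, w} \<subseteq> verts G" "distinct [u, v, w]"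
  interpret s: comatching_graph G B A "prod.swap ` M"
    by (rule swap)
  have M': "card (prod.swap ` M) = card M"
    by (rule card_image) simp
  have AAB: "\<exists>p. monophonic_path G p \<and> {x, y, z} \<subseteq> set p" if "x \<in> A" "y \<in> A" "z \<in> B" "x \<noteq> y" for x y z
    using triple_AAB_on_path that assms by blast
  have BBA: "\<exists>p. monophonic_path G p \<and> {x, y, z} \<subseteq> set p" if "x \<in> B" "y \<in> B" "z \<in> A" "x \<noteq> y" for x y z
    using s.triple_AAB_on_path that assms by blast
  consider "{u, v, w} \<subseteq> A" | "{u, v, w} \<subseteq> B"
    | "u \<in> A" "v \<in> A" "w \<in> B" | "u \<in> A" "v \<in> B" "w \<in> A" | "u \<in> B" "v \<in> A" "w \<in> A"
    | "u \<in> B" "v \<in> B" "w \<in> A" | "u \<in> B" "v \<in> A" "w \<in> B" | "u \<in> A" "v \<in> B" "w \<in> B"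
    using uvw(1) verts by auto
  then show "\<exists>p. monophonic_path G p \<and> {u, v, w} \<subseteq> set p"
  proof cases
    case 1
    then show ?thesis using triple_AAA_on_path uvw assms by blast
  next
    case 2
    then show ?thesis using s.triple_AAA_on_path[of u v w] uvw assms M' by simp
  next
    case 3
    then show ?thesis using AAB[of u v w] uvw by simp
  next
    case 4
    then show ?thesis using AAB[of u w v] uvw by (auto simp: insert_commute)
  next
    case 5
    then show ?thesis using AAB[of v w u] uvw by (auto simp: insert_commute)
  next
    case 6
    then show ?thesis using BBA[of u v w] uvw by simp
  next
    case 7
    then show ?thesis using BBA[of u w v] uvw by (auto simp: insert_commute)
  next
    case 8
    then show ?thesis using BBA[of v w u] uvw by (auto simp: insert_commute)
  qed
qed

lemma bij_betw_extend:
  assumes fin: "finite X" "finite Y" and card: "card X = card Y"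
    and S: "S \<subseteq> X" and T: "T \<subseteq> Y" and f: "bij_betw f S T"
  obtains g where "bij_betw g X Y" "\<And>x. x \<in> S \<Longrightarrow> g x = f x"
proof -
  have "finite (X - S)" "finite (Y - T)"
    using fin by auto
  moreover have "card (X - S) = card (Y - T)"
    using assms bij_betw_same_card[OF f] by (metis card_Diff_subset finite_subset)
  ultimately obtain h where h: "bij_betw h (X - S) (Y - T)"
    by (metis finite_same_card_bij)
  let ?g = "\<lambda>x. if x \<in> S then f x else h x"
  have "bij_betw ?g S T"
    using f by (subst bij_betw_cong[of _ _ f]) auto
  moreover have "bij_betw ?g (X - S) (Y - T)"
    using h by (subst bij_betw_cong[of _ _ h]) auto
  ultimately have "bij_betw ?g (S \<union> (X - S)) (T \<union> (Y - T))"
    by (rule bij_betw_combine) auto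
  moreover have "S \<union> (X - S) = X" "T \<union> (Y - T) = Y"
    using S T by auto
  ultimately show thesis
    using that[of ?g] by simp
qed

lemma comatching_graph_isomorphic:
  assumes "comatching_graph G A B M" "comatching_graph H A' B' M'"
    and "card A = card A'" "card B = card B'" "card M = card M'"
  shows "isomorphic G H"
proof -
  interpret G: comatching_graph G A B M by fact
  interpret H: comatching_graph H A' B' M' by fact
  obtain k where k: "bij_betw k M M'"
    using finite_same_card_bij G.finite_M H.finite_M assms(5) by blast
  have fst: "bij_betw fst M (fst ` M)" "bij_betw fst M' (fst ` M')"
    and snd: "bij_betw snd M (snd ` M)" "bij_betw snd M' (snd ` M')"
    using G.M H.M by (auto simp: bij_betw_def)
  have sub: "fst ` M \<subseteq> A" "fst ` M' \<subseteq> A'" "snd ` M \<subseteq> B" "snd ` M' \<subseteq> B'"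
    using G.M(1) H.M(1) by auto
  have "bij_betw (fst \<circ> k \<circ> inv_into M fst) (fst ` M) (fst ` M')"
    using fst k by (intro bij_betw_trans[of _ _ M]) (auto intro: bij_betw_inv_into bij_betw_trans)
  then obtain g where g: "bij_betw g A A'"
    "\<And>x. x \<in> fst ` M \<Longrightarrow> g x = (fst \<circ> k \<circ> inv_into M fst) x"
    by (rule bij_betw_extend[OF G.finite_A H.finite_A assms(3) sub(1) sub(2)]) blast
  have "bij_betw (snd \<circ> k \<circ> inv_into M snd) (snd ` M) (snd ` M')"
    using snd k by (intro bij_betw_trans[of _ _ M]) (auto intro: bij_betw_inv_into bij_betw_trans)
  then obtain h where h: "bij_betw h B B'"
    "\<And>x. x \<in> snd ` M \<Longrightarrow> h x = (snd \<circ> k \<circ> inv_into M snd) x"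
    by (rule bij_betw_extend[OF G.finite_B H.finite_B assms(4) sub(3) sub(4)]) blast
  have gh: "(g x, h y) = k (x, y)" if "(x, y) \<in> M" for x y
  proof -
    have "inv_into M fst x = (x, y)" "inv_into M snd y = (x, y)"
      using that G.M inv_into_f_eq[of fst M "(x, y)" x] inv_into_f_eq[of snd M "(x, y)" y] by auto
    moreover have "x \<in> fst ` M" "y \<in> snd ` M"
      using that by force+
    ultimately show ?thesis
      using g(2) h(2) by simp
  qed
  have M_iff: "(g x, h y) \<in> M' \<longleftrightarrow> (x, y) \<in> M" if xy: "x \<in> A" "y \<in> B" for x y
  proof
    assume "(x, y) \<in> M"
    then show "(g x, h y) \<in> M'"
      using gh k bij_betwE by metis
  next
    assume "(g x, h y) \<in> M'"
    then obtain x' y' where x'y': "(x', y') \<in> M" "k (x', y') = (g x, h y)"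
      using k by (metis bij_betw_imp_surj_on imageE surj_pair)
    then have "g x' = g x" "h y' = h y" "x' \<in> A" "y' \<in> B"
      using gh[of x' y'] G.M(1) by auto
    then show "(x, y) \<in> M"
      using x'y'(1) xy g(1) h(1) by (metis bij_betw_imp_inj_on inj_onD)
  qed
  let ?f = "\<lambda>x. if x \<in> A then g x else h x"
  have fA: "bij_betw ?f A A'"
    using g(1) by (subst bij_betw_cong[of _ _ g]) auto
  have fB: "bij_betw ?f B B'"
    using h(1) G.disjoint by (subst bij_betw_cong[of _ _ h]) auto
  have f_bij: "bij_betw ?f (verts G) (verts H)"
    unfolding G.verts H.verts using fA fB H.disjoint by (rule bij_betw_combine)
  have AB: "{u, v} \<in> edges G \<longleftrightarrow> {?f u, ?f v} \<in> edges H" if uv: "u \<in> A" "v \<in> B" for u v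
  proof -
    have "v \<notin> A" "g u \<in> A'" "h v \<in> B'"
      using uv G.disjoint bij_betwE[OF g(1)] bij_betwE[OF h(1)] by auto
    then show ?thesis
      using uv G.edge_iff H.edge_iff M_iff by simp
  qed
  have "{u, v} \<in> edges G \<longleftrightarrow> {?f u, ?f v} \<in> edges H" if uv: "u \<in> A \<union> B" "v \<in> A \<union> B" for u v
  proof -
    consider "u \<in> A" "v \<in> B" | "v \<in> A" "u \<in> B" | "u \<in> A" "v \<in> A" | "u \<in> B" "v \<in> B"
      using uv by blast
    then show ?thesis
    proof cases
      case 1
      then show ?thesis by (rule AB)
    next
      case 2
      then show ?thesis using AB[of v u] by (simp only: insert_commute)
    next
      case 3
      then show ?thesis
        using G.no_edge_A H.no_edge_A bij_betwE[OF fA] by blast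
    next
      case 4
      then show ?thesis
        using G.no_edge_B H.no_edge_B bij_betwE[OF fB] by blast
    qed
  qed
  then show ?thesis
    unfolding isomorphic_def using f_bij G.verts by (intro exI[of _ ?f]) simp
qed

section \<open>The extremal graphs\<close>

lemma card_bipartition_extremal:
  fixes a b c e :: nat
  assumes "e + c = a * b" "a \<le> c + 1" "b \<le> a" "1 \<le> a" "(a + b - 1)\<^sup>2 \<le> 4 * e"
  shows "a \<le> b + 1" "c + 1 = a"
proof -
  have "int ((a + b - 1)\<^sup>2) \<le> int (4 * e)"
    using assms(5) by (rule of_nat_mono)
  then have "(int a + int b - 1)\<^sup>2 \<le> 4 * int e"
    using assms(4) by (simp add: of_nat_diff)
  moreover have "int e = int a * int b - int c"
    using arg_cong[OF assms(1), of int] by simp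
  ultimately have key: "(int a - int b)\<^sup>2 + 4 * int c + 1 \<le> 2 * int a + 2 * int b"
    by (simp add: power2_eq_square algebra_simps)
  show le: "a \<le> b + 1"
  proof (rule ccontr)
    assume "\<not> a \<le> b + 1"
    then have "2 * 2 \<le> (int a - int b) * (int a - int b)"
      by (intro mult_mono) auto
    then show False
      using key assms(2,3) by (simp add: power2_eq_square)
  qed
  then consider "a = b" | "a = b + 1"
    using assms(3) by linarith
  then show "c + 1 = a"
    by cases (use key assms(2) in auto)
qed

lemma (in dense_mp2_graph) comatching:
  obtains A B M where "comatching_graph G A B M" "card A = (card (verts G) + 1) div 2"
    "card B = card (verts G) div 2" "card M = (card (verts G) - 1) div 2"
proof -
  obtain A B where AB: "A \<union> B = verts G" "A \<inter> B = {}" "card B \<le> card A"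
    and indep: "\<And>u v. u \<in> A \<Longrightarrow> v \<in> A \<Longrightarrow> \<not> adj u v" "\<And>u v. u \<in> B \<Longrightarrow> v \<in> B \<Longrightarrow> \<not> adj u v"
  proof -
    obtain A B where "A \<union> B = verts G" "A \<inter> B = {}"
      "\<And>u v. u \<in> A \<Longrightarrow> v \<in> A \<Longrightarrow> \<not> adj u v" "\<And>u v. u \<in> B \<Longrightarrow> v \<in> B \<Longrightarrow> \<not> adj u v"
      using bipartition by blast
    then show thesis
      using that[of A B] that[of B A] by (cases "card B \<le> card A") (auto simp: Un_commute Int_commute)
  qed
  have fin: "finite A" "finite B"
    using AB(1) finite_verts by (metis finite_Un)+
  have n: "card (verts G) = card A + card B"
    using card_Un_disjoint[OF fin AB(2)] AB(1) by simp
  define M where "M = {(x, y) \<in> A \<times> B. \<not> adj x y}"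
  have M: "M \<subseteq> A \<times> B" "finite M"
    using fin finite_subset[of M "A \<times> B"] by (auto simp: M_def)
  have edges: "edges G = (\<lambda>(x, y). {x, y}) ` (A \<times> B - M)"
  proof
    show "edges G \<subseteq> (\<lambda>(x, y). {x, y}) ` (A \<times> B - M)"
    proof
      fix f assume "f \<in> edges G"
      then obtain u v where f: "f = {u, v}" and uv: "adj u v"
        by (rule edge_cases)
      then have "u \<in> A \<and> v \<in> B \<or> v \<in> A \<and> u \<in> B"
        using adj_verts[OF uv] indep AB(1) by blast
      then have "(u, v) \<in> A \<times> B - M \<or> (v, u) \<in> A \<times> B - M"
        using uv adj_commute by (auto simp: M_def)
      then show "f \<in> (\<lambda>(x, y). {x, y}) ` (A \<times> B - M)"
        unfolding f by (auto simp: image_iff insert_commute intro: bexI[rotated])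
    qed
    show "(\<lambda>(x, y). {x, y}) ` (A \<times> B - M) \<subseteq> edges G"
      by (auto simp: M_def adj_def)
  qed
  have nbh_A: "nbh x = {y \<in> B. (x, y) \<notin> M}" if "x \<in> A" for x
  proof (rule set_eqI)
    fix y
    show "y \<in> nbh x \<longleftrightarrow> y \<in> {y \<in> B. (x, y) \<notin> M}"
      using that indep(1)[OF that, of y] adj_verts(2)[of x y] by (auto simp: nbh_iff M_def AB(1)[symmetric])
  qed
  have "x = x'" if x: "x \<in> A - fst ` M" "x' \<in> A - fst ` M" for x x'
  proof (rule twin_free)
    show "nbh x = nbh x'"
      using x nbh_A by force
  qed (use x AB(1) in auto)
  then have "card (A - fst ` M) \<le> 1"
    using card_le_Suc0_iff_eq[of "A - fst ` M"] fin by auto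
  moreover have "card (A - fst ` M) = card A - card (fst ` M)"
    by (rule card_Diff_subset) (use M in auto)
  ultimately have fstM: "card A \<le> card (fst ` M) + 1"
    by simp
  have "card (fst ` M) \<le> card M"
    using M(2) by (rule card_image_le)
  moreover have "card (edges G) + card M = card A * card B"
    using card_bipartite_edges[OF fin AB(2) M(1)] edges by simp
  ultimately have sizes: "card A \<le> card B + 1" "card M + 1 = card A"
    using card_bipartition_extremal[of "card (edges G)" "card M" "card A" "card B"]
      fstM AB(3) dense n order by auto
  then have inj_fst: "inj_on fst M"
    using fstM \<open>card (fst ` M) \<le> card M\<close> M(2) by (intro eq_card_imp_inj_on) auto
  have "inj_on snd M"
  proof (rule inj_onI)
    fix s t assume st: "s \<in> M" "t \<in> M" "snd s = snd t"
    have nbh_M: "nbh (fst r) = B - {snd r}" if "r \<in> M" for r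
    proof -
      have "(fst r, y) \<in> M \<longleftrightarrow> y = snd r" for y
        using that inj_onD[OF inj_fst, of r "(fst r, y)"] by (cases r) auto
      then show ?thesis
        using that M(1) nbh_A[of "fst r"] by auto
    qed
    have "fst s = fst t"
    proof (rule twin_free)
      show "nbh (fst s) = nbh (fst t)"
        using st nbh_M by simp
    qed (use st M(1) in \<open>auto simp: AB(1)[symmetric]\<close>)
    then show "s = t"
      using st(3) by (simp add: prod_eq_iff)
  qed
  then have "comatching_graph G A B M"
    using fin AB M edges inj_fst by unfold_locales auto
  moreover have "card A = card B \<or> card A = card B + 1"
    using sizes(1) AB(3) by linarith
  ultimately show thesis
    using that[of A B M] sizes(2) n by fastforce
qed

definition extremal_size :: "nat \<Rightarrow> nat" where
  "extremal_size n = (n + 1) div 2 * (n div 2) - (n - 1) div 2"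

lemma extremal_size_bounds:
  assumes "n \<ge> 1"
  shows "(n - 1)\<^sup>2 \<le> 4 * extremal_size n" "4 * extremal_size n < (n - 1)\<^sup>2 + 4"
proof -
  have "(n - 1)\<^sup>2 \<le> 4 * extremal_size n \<and> 4 * extremal_size n < (n - 1)\<^sup>2 + 4"
  proof (cases "even n")
    case True
    then obtain k where "n = 2 * Suc k"
      using assms by (metis evenE mult_0_right not_one_le_zero old.nat.exhaust)
    then show ?thesis
      by (simp add: extremal_size_def power2_eq_square algebra_simps)
  next
    case False
    then obtain k where "n = 2 * k + 1"
      by (metis oddE)
    then show ?thesis
      by (simp add: extremal_size_def power2_eq_square algebra_simps)
  qed
  then show "(n - 1)\<^sup>2 \<le> 4 * extremal_size n" "4 * extremal_size n < (n - 1)\<^sup>2 + 4"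
    by auto
qed

lemma extremal_size_eq_ceiling:
  assumes "n \<ge> 1"
  shows "int (extremal_size n) = \<lceil>(real n - 1)\<^sup>2 / 4\<rceil>"
proof (rule ceiling_unique[symmetric])
  have n: "(real n - 1)\<^sup>2 = real ((n - 1)\<^sup>2)"
    using assms by (simp add: of_nat_diff)
  have "real ((n - 1)\<^sup>2) \<le> real (4 * extremal_size n)"
    "real (4 * extremal_size n) < real ((n - 1)\<^sup>2 + 4)"
    using extremal_size_bounds[OF assms] by (simp_all only: of_nat_le_iff of_nat_less_iff)
  then show "(real n - 1)\<^sup>2 / 4 \<le> of_int (int (extremal_size n))"
    "of_int (int (extremal_size n)) - 1 < (real n - 1)\<^sup>2 / 4"
    unfolding n by simp_all
qed

locale extremal_comatching_graph = comatching_graph +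
  fixes n :: nat
  assumes n: "n \<ge> 6" and card_A: "card A = (n + 1) div 2" and card_B: "card B = n div 2"
    and card_M: "card M = (n - 1) div 2"
begin

lemma order_eq: "graph_order G = n"
  using order card_A card_B by presburger

lemma size_eq: "graph_size G = extremal_size n"
  using size unfolding extremal_size_def card_A card_B card_M by linarith

lemma mp_number_eq: "mp_number G = 2"
  by (rule mp_number) (use n card_A card_B card_M in presburger)+

end

lemma mp2_graph_extremal:
  assumes "simple_graph G" "graph_order G = n" "mp_number G = 2" "n \<ge> 6"
    and "(n - 1)\<^sup>2 \<le> 4 * graph_size G"
  obtains A B M where "extremal_comatching_graph G A B M n"
proof -
  interpret dense_mp2_graph G
    using assms by unfold_locales (auto simp: graph_order_def graph_size_def)
  show thesis
    using comatching that assms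
    by (metis extremal_comatching_graph.intro extremal_comatching_graph_axioms.intro graph_order_def)
qed

lemma mp2_graph_size_le:
  assumes "simple_graph G" "graph_order G = n" "mp_number G = 2" "n \<ge> 6"
  shows "graph_size G \<le> extremal_size n"
proof (cases "(n - 1)\<^sup>2 \<le> 4 * graph_size G")
  case True
  then show ?thesis
    using mp2_graph_extremal[OF assms True] extremal_comatching_graph.size_eq by (metis order_refl)
next
  case False
  then show ?thesis
    using extremal_size_bounds(1)[of n] assms(4) by linarith
qed

lemma ex_extremal_comatching_graph:
  assumes "n \<ge> 6"
  obtains G :: "nat graph" and A B M where "extremal_comatching_graph G A B M n"
proof -
  let ?a = "(n + 1) div 2" and ?b = "n div 2"
  let ?A = "{..<?a}" and ?B = "{?a..<?a + ?b}" and ?M = "(\<lambda>i. (i, ?a + i)) ` {..<(n - 1) div 2}"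
  have "card ?M = (n - 1) div 2"
    by (subst card_image) (auto simp: inj_on_def)
  then have "extremal_comatching_graph (Graph (?A \<union> ?B) ((\<lambda>(x, y). {x, y}) ` (?A \<times> ?B - ?M))) ?A ?B ?M n"
    using assms by unfold_locales (auto simp: inj_on_def)
  then show thesis
    by (rule that)
qed

lemma mex_2_eq:
  assumes "n \<ge> 6"
  shows "mex n 2 = extremal_size n"
  unfolding mex_def
proof (rule Max_eqI)
  show le: "s \<le> extremal_size n"
    if "s \<in> {graph_size G |G :: nat graph. simple_graph G \<and> graph_order G = n \<and> mp_number G = 2}" for s
    using that mp2_graph_size_le assms by blast
  show "finite {graph_size G |G :: nat graph. simple_graph G \<and> graph_order G = n \<and> mp_number G = 2}"
    using le by (meson finite_nat_set_iff_bounded_le)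
  obtain G :: "nat graph" and A B M where "extremal_comatching_graph G A B M n"
    using ex_extremal_comatching_graph[OF assms] .
  then interpret extremal_comatching_graph G A B M n .
  show "extremal_size n \<in> {graph_size G |G :: nat graph. simple_graph G \<and> graph_order G = n \<and> mp_number G = 2}"
    using simple order_eq mp_number_eq size_eq by (auto intro!: exI[of _ G])
qed

lemma (in extremal_comatching_graph) unique_extremal: "unique_extremal TYPE('b) n G"
  unfolding unique_extremal_def
proof (intro conjI allI impI)
  show "extremal n G"
    using simple order_eq mp_number_eq size_eq mex_2_eq[OF n] by (simp add: extremal_def)
next
  fix G' :: "'b graph"
  assume G': "extremal n G'"
  then have "(n - 1)\<^sup>2 \<le> 4 * graph_size G'"
    using extremal_size_bounds(1)[of n] n mex_2_eq[OF n] by (simp add: extremal_def)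
  then obtain A' B' M' where "extremal_comatching_graph G' A' B' M' n"
    using mp2_graph_extremal[of G' n] G' n by (auto simp: extremal_def)
  then interpret G': extremal_comatching_graph G' A' B' M' n .
  show "isomorphic G' G"
    by (rule comatching_graph_isomorphic[OF G'.comatching_graph_axioms comatching_graph_axioms])
      (simp_all add: card_A card_B card_M G'.card_A G'.card_B G'.card_M)
qed

lemma extremal_T_base_minus:
  assumes "n \<ge> 6" "I \<subseteq> {..<n div 2}" "card I = (n - 1) div 2"
  shows "extremal_comatching_graph (delete_edges (T_base n) {{Inl i, Inr i} | i. i \<in> I})
    (Inl ` {..<(n + 1) div 2}) (Inr ` {..<n div 2}) ((\<lambda>i. (Inl i, Inr i)) ` I) n"
proof
  show "edges (delete_edges (T_base n) {{Inl i, Inr i} |i. i \<in> I}) =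
    (\<lambda>(x, y). {x, y}) ` (Inl ` {..<(n + 1) div 2} \<times> Inr ` {..<n div 2} - (\<lambda>i. (Inl i, Inr i)) ` I)"
    by (fastforce simp: delete_edges_def T_base_def complete_bipartite_def doubleton_eq_iff image_iff)
  show "card ((\<lambda>i. (Inl i, Inr i)) ` I) = (n - 1) div 2"
    using assms(3) by (subst card_image) (auto simp: inj_on_def)
qed (use assms in \<open>auto simp: delete_edges_def T_base_def complete_bipartite_def card_image inj_on_def\<close>)

lemma T_star_missing_eq: "T_star_missing n = {{Inl i, Inr i} | i. i < n div 2}"
  by (fastforce simp: T_star_missing_def T_star_def delete_edges_def T_base_def complete_bipartite_def)

theorem theorem3p6:
  fixes n :: nat
  assumes "n \<ge> 6"
  shows "int (mex n 2) = \<lceil>(real n - 1)\<^sup>2 / 4\<rceil>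
    \<and> (odd n \<longrightarrow> unique_extremal TYPE('a) n (T_star n))
    \<and> (even n \<longrightarrow>
         T_star_missing n \<noteq> {} \<and>
         (\<forall>e \<in> T_star_missing n. unique_extremal TYPE('a) n (add_edge (T_star n) e)))"
proof (intro conjI impI ballI)
  show "int (mex n 2) = \<lceil>(real n - 1)\<^sup>2 / 4\<rceil>"
    using mex_2_eq extremal_size_eq_ceiling assms by simp
next
  assume "odd n"
  then have "card {..<n div 2} = (n - 1) div 2"
    by (auto elim: oddE)
  then show "unique_extremal TYPE('a) n (T_star n)"
    using extremal_comatching_graph.unique_extremal[OF extremal_T_base_minus[OF assms order_refl]]
    by (simp add: T_star_def)
next
  show "T_star_missing n \<noteq> {}"
    using assms by (auto simp: T_star_missing_eq intro!: exI[of _ 0])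
next
  fix e assume "even n" and e: "e \<in> T_star_missing n"
  obtain t where t: "t < n div 2" "e = {Inl t, Inr t}"
    using e by (auto simp: T_star_missing_eq)
  let ?I = "{..<n div 2} - {t}"
  have "card ?I = (n - 1) div 2"
    using t(1) \<open>even n\<close> by (auto elim!: evenE)
  moreover have "add_edge (T_star n) e = delete_edges (T_base n) {{Inl i, Inr i} | i. i \<in> ?I}"
    using t by (fastforce simp: add_edge_def T_star_def delete_edges_def T_base_def
        complete_bipartite_def doubleton_eq_iff)
  ultimately show "unique_extremal TYPE('a) n (add_edge (T_star n) e)"
    using extremal_comatching_graph.unique_extremal[OF extremal_T_base_minus[OF assms, of ?I]] by auto
qed

end
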